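(* Let $d\ge2$ be an integer, and let $L\in\mathbb{N}_0$ and $y\in\mathbb{S}^{d-1}$ be given. Every function from the ansatz space $\widetilde{\mathcal{P}}_L(\mathbb{R}^{d-1},\pi,y)$ of polynomials on the tangent space is the restriction of an element of $\mathcal{H}_L(\mathbb{S}^{d-1})$ to the domain of this function, i.e. for every $\widetilde p\in\widetilde{\mathcal{P}}_L(\mathbb{R}^{d-1},\pi,y)$ there exists $h\in\mathcal{H}_L(\mathbb{S}^{d-1})$ such that $$\widetilde p(z)=h(z)\qquad\text{for all }z\in C_{\pi/2}(y).$$
   Context: $\mathbb{S}^{d-1}=\{y\in\mathbb{R}^d : \|y\|_2=1\}$, $e_d=(0,\dots,0,1)$, and $C_\delta(y)=\{z\in\mathbb{S}^{d-1} : \arccos(\langle y,z\rangle)<\delta\}$. All spaces are linear spaces of $\mathbb{K}$-valued functions over a fixed field $\mathbb{K}\in\{\mathbb{R},\mathbb{C}\}$. $\mathcal{H}_L(\mathbb{S}^{d-1})=\bigoplus_{\ell=0}^L\mathrm{Harm}_\ell(\mathbb{S}^{d-1})$ is the space of spherical harmonics up to degree $L$, where $\mathrm{Harm}_\ell(\mathbb{S}^{d-1})=\{h|_{\mathbb{S}^{d-1}} : h\in\mathrm{Hom}_\ell(\mathbb{R}^d),\ \Delta_d h\equiv0\}$, $\mathrm{Hom}_\ell(\mathbb{R}^d)$ is the space of homogeneous polynomials of degree $\ell$ on $\mathbb{R}^d$ (including $0$) and $\Delta_d$ is the Laplacian. $\mathcal{P}_L(\mathbb{R}^{d-1})$ is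 the space of polynomials on $\mathbb{R}^{d-1}$ of total degree at most $L$. The projection $\pi$ from the open unit ball $B_1(0)\subset\mathbb{R}^{d-1}$ onto $C_{\pi/2}(e_d)$ is $\pi(x_1,\dots,x_{d-1})=(x_1,\dots,x_{d-1},\sqrt{1-\|x\|_2^2})$, with inverse $\pi^{-1}(y_1,\dots,y_d)=(y_1,\dots,y_{d-1})$. For $y\in\mathbb{S}^{d-1}$ let $\mathbf{R}_y\in\mathcal{SO}(d)$ be a rotation matrix with $\mathbf{R}_y y=e_d$; then $\widetilde{\mathcal{P}}_L(\mathbb{R}^{d-1},\pi,y)=\{p\circ\pi^{-1}\circ\mathbf{R}_y : p\in\mathcal{P}_L(\mathbb{R}^{d-1})\}$, a space of functions on $C_{\pi/2}(y)$ (which does not depend on the particular choice of $\mathbf{R}_y$). *)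

theory Defs
  imports "HOL-Analysis.Analysis" "Jordan_Normal_Form.Determinant"
begin

unbundle no vec_syntax and no inner_syntax

text \<open>
  Since \<open>d\<close> and \<open>d - 1\<close> occur together, \<open>\<real>\<^sup>n\<close> is \<open>carrier_vec n :: real vec set\<close> with 0-based
  coordinates, \<open>\<bullet>\<close> is \<open>scalar_prod\<close> and \<open>\<parallel>x\<parallel>\<^sub>2 = sqrt (x \<bullet> x)\<close>.
  A function on a domain \<open>D\<close> is an element of \<open>extensional D\<close> (\<open>undefined\<close> outside \<open>D\<close>).
  The scalar field is an arbitrary type \<open>'k :: real_normed_field\<close>; up to isomorphism of real
  algebras these are exactly \<open>\<real>\<close> and \<open>\<complex>\<close>.
\<close>

subsection \<open>Sphere, caps, rotations\<close>

definition unit_sphere :: "nat \<Rightarrow> real vec set" where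
  "unit_sphere d = {y \<in> carrier_vec d. sqrt (y \<bullet> y) = 1}"

definition north_pole :: "nat \<Rightarrow> real vec" where
  "north_pole d = unit_vec d (d - 1)"

definition cap :: "nat \<Rightarrow> real \<Rightarrow> real vec \<Rightarrow> real vec set" where
  "cap d \<delta> y = {z \<in> unit_sphere d. arccos (y \<bullet> z) < \<delta>}"

definition special_orthogonal :: "nat \<Rightarrow> real mat set" where
  "special_orthogonal d =
     {R \<in> carrier_mat d d. transpose_mat R * R = 1\<^sub>m d \<and> Determinant.det R = 1}"

subsection \<open>Polynomial functions\<close>

text \<open>A multi-index \<open>\<alpha> \<in> \<nat>\<^sup>n\<close> is a list of length \<open>n\<close>; \<open>sum_list \<alpha>\<close> is its order.\<close>

definition monomial_fun :: "nat list \<Rightarrow> real vec \<Rightarrow> real" where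
  "monomial_fun \<alpha> x = (\<Prod>i<length \<alpha>. (x $ i) ^ (\<alpha> ! i))"

definition homogeneous_polys :: "nat \<Rightarrow> nat \<Rightarrow> (real vec \<Rightarrow> 'k::real_normed_field) set" where
  "homogeneous_polys n k =
     {\<lambda>x\<in>carrier_vec n. \<Sum>\<alpha> | length \<alpha> = n \<and> sum_list \<alpha> = k. c \<alpha> * of_real (monomial_fun \<alpha> x) | c. True}"

definition polys :: "nat \<Rightarrow> nat \<Rightarrow> (real vec \<Rightarrow> 'k::real_normed_field) set" where
  "polys n L =
     {\<lambda>x\<in>carrier_vec n. \<Sum>\<alpha> | length \<alpha> = n \<and> sum_list \<alpha> \<le> L. c \<alpha> * of_real (monomial_fun \<alpha> x) | c. True}"

text \<open>The sums above range over finite sets, so they are not \<open>0\<close> by convention.\<close>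

lemma finite_multi_indices:
  "finite {\<alpha>. length \<alpha> = n \<and> sum_list \<alpha> \<le> (L::nat)}"
  "finite {\<alpha>. length \<alpha> = n \<and> sum_list \<alpha> = (L::nat)}"
proof -
  have "finite {\<alpha>. set \<alpha> \<subseteq> {..L} \<and> length \<alpha> = n}"
    by (rule finite_lists_length_eq) simp
  moreover have "{\<alpha>. length \<alpha> = n \<and> sum_list \<alpha> \<le> L} \<subseteq> {\<alpha>. set \<alpha> \<subseteq> {..L} \<and> length \<alpha> = n}"
    using member_le_sum_list order_trans by fastforce
  ultimately show 1: "finite {\<alpha>. length \<alpha> = n \<and> sum_list \<alpha> \<le> L}"
    by (rule rev_finite_subset)
  show "finite {\<alpha>. length \<alpha> = n \<and> sum_list \<alpha> = L}"
    by (rule finite_subset[OF _ 1]) auto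
qed

subsection \<open>Spherical harmonics\<close>

definition partial_deriv :: "nat \<Rightarrow> nat \<Rightarrow> (real vec \<Rightarrow> 'k::real_normed_field) \<Rightarrow> real vec \<Rightarrow> 'k" where
  "partial_deriv d i f x = vector_derivative (\<lambda>t. f (x + t \<cdot>\<^sub>v unit_vec d i)) (at 0)"

definition laplacian :: "nat \<Rightarrow> (real vec \<Rightarrow> 'k::real_normed_field) \<Rightarrow> real vec \<Rightarrow> 'k" where
  "laplacian d f x = (\<Sum>i<d. partial_deriv d i (partial_deriv d i f) x)"

definition Harm :: "nat \<Rightarrow> nat \<Rightarrow> (real vec \<Rightarrow> 'k::real_normed_field) set" where
  "Harm d k = {restrict h (unit_sphere d) | h.
     h \<in> homogeneous_polys d k \<and> (\<forall>x\<in>carrier_vec d. laplacian d h x = 0)}"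

text \<open>
  The sum of the subspaces \<open>Harm d k\<close>, \<open>k \<le> L\<close>. That it is direct is a property of these subspaces,
  not a restriction on the elements of the sum.
\<close>

definition spherical_harmonics :: "nat \<Rightarrow> nat \<Rightarrow> (real vec \<Rightarrow> 'k::real_normed_field) set" where
  "spherical_harmonics d L =
     {\<lambda>z\<in>unit_sphere d. \<Sum>k\<le>L. h k z | h. \<forall>k\<le>L. h k \<in> Harm d k}"

subsection \<open>Polynomials on the tangent space\<close>

definition open_unit_ball :: "nat \<Rightarrow> real vec set" where
  "open_unit_ball n = {x \<in> carrier_vec n. sqrt (x \<bullet> x) < 1}"

definition proj :: "nat \<Rightarrow> real vec \<Rightarrow> real vec" where
  "proj d x = vec d (\<lambda>i. if i < d - 1 then x $ i else sqrt (1 - x \<bullet> x))"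

definition proj_inv :: "nat \<Rightarrow> real vec \<Rightarrow> real vec" where
  "proj_inv d y = vec_first y (d - 1)"

lemma scalar_prod_split_last:
  fixes x y :: "real vec"
  assumes "d \<ge> 1" "y \<in> carrier_vec d"
  shows "x \<bullet> y = vec_first x (d - 1) \<bullet> vec_first y (d - 1) + x $ (d - 1) * y $ (d - 1)"
proof -
  have d: "{0..<d} = insert (d - 1) {0..<d - 1}" using assms(1) by auto
  show ?thesis using assms(2)
    by (auto simp: scalar_prod_def vec_first_def d intro!: sum.cong)
qed

lemma proj_bij:
  assumes "d \<ge> 1"
  shows "bij_betw (proj d) (open_unit_ball (d - 1)) (cap d (pi / 2) (north_pole d))"
    and "x \<in> open_unit_ball (d - 1) \<Longrightarrow> proj_inv d (proj d x) = x"
    and "y \<in> cap d (pi / 2) (north_pole d) \<Longrightarrow> proj d (proj_inv d y) = y"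
proof -
  have pole: "north_pole d \<bullet> y = y $ (d - 1)" if "y \<in> carrier_vec d" for y :: "real vec"
    using that assms by (simp add: north_pole_def)
  have split: "y \<bullet> y = proj_inv d y \<bullet> proj_inv d y + (y $ (d - 1))\<^sup>2"
    if "y \<in> carrier_vec d" for y :: "real vec"
    using scalar_prod_split_last[OF assms that, of y] by (simp add: proj_inv_def power2_eq_square)
  have nonneg: "0 \<le> x \<bullet> x" for x :: "real vec"
    by (auto simp: scalar_prod_def intro!: sum_nonneg)
  have arccos_iff: "arccos t < pi / 2 \<longleftrightarrow> 0 < t" if "\<bar>t\<bar> \<le> 1" for t
  proof
    show "arccos t < pi / 2" if "0 < t"
      using arccos_less_arccos[of 0 t] that \<open>\<bar>t\<bar> \<le> 1\<close> by simp
    show "0 < t" if "arccos t < pi / 2"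
    proof (rule ccontr)
      assume "\<not> 0 < t"
      then have "arccos 0 \<le> arccos t"
        using \<open>\<bar>t\<bar> \<le> 1\<close> by (intro arccos_le_arccos) auto
      with that show False by simp
    qed
  qed
  have cap_iff: "y \<in> cap d (pi / 2) (north_pole d) \<longleftrightarrow>
      y \<in> carrier_vec d \<and> y \<bullet> y = 1 \<and> 0 < y $ (d - 1)" for y
  proof (cases "y \<in> carrier_vec d \<and> y \<bullet> y = 1")
    case True
    with split[of y] nonneg[of "proj_inv d y"] have "(y $ (d - 1))\<^sup>2 \<le> 1" by simp
    then have "\<bar>y $ (d - 1)\<bar> \<le> 1" by (simp add: abs_square_le_1)
    with True arccos_iff[OF this] show ?thesis by (simp add: cap_def unit_sphere_def pole)
  qed (auto simp: cap_def unit_sphere_def)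
  have fst: "proj_inv d (proj d x) = x" if "x \<in> carrier_vec (d - 1)" for x
    using that assms by (auto simp: proj_inv_def proj_def vec_first_def intro!: eq_vecI)
  show inv1: "proj_inv d (proj d x) = x" if "x \<in> open_unit_ball (d - 1)" for x
    using that fst by (simp add: open_unit_ball_def)
  show inv2: "proj d (proj_inv d y) = y" if "y \<in> cap d (pi / 2) (north_pole d)" for y
  proof (rule eq_vecI)
    have y: "y \<in> carrier_vec d" "y \<bullet> y = 1" "0 < y $ (d - 1)" using that cap_iff by auto
    have "1 - proj_inv d y \<bullet> proj_inv d y = (y $ (d - 1))\<^sup>2" using split[OF y(1)] y(2) by simp
    with y(3) have last: "sqrt (1 - proj_inv d y \<bullet> proj_inv d y) = y $ (d - 1)" by simp
    show "dim_vec (proj d (proj_inv d y)) = dim_vec y" using y by (simp add: proj_def)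
    show "proj d (proj_inv d y) $ i = y $ i" if "i < dim_vec y" for i
    proof (cases "i < d - 1")
      case True
      then show ?thesis by (simp add: proj_def proj_inv_def vec_first_def)
    next
      case False
      with that y(1) have "i = d - 1" by auto
      with last assms show ?thesis by (simp add: proj_def)
    qed
  qed
  have img: "proj d x \<in> cap d (pi / 2) (north_pole d)" if "x \<in> open_unit_ball (d - 1)" for x
  proof -
    from that have x: "x \<in> carrier_vec (d - 1)" "x \<bullet> x < 1" by (auto simp: open_unit_ball_def)
    have c: "proj d x \<in> carrier_vec d" by (simp add: proj_def)
    have l: "proj d x $ (d - 1) = sqrt (1 - x \<bullet> x)" using assms by (simp add: proj_def)
    show ?thesis using split[OF c] x c l fst[OF x(1)] by (simp add: cap_iff)
  qed
  have img': "proj_inv d y \<in> open_unit_ball (d - 1)" if "y \<in> cap d (pi / 2) (north_pole d)" for y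
  proof -
    have y: "y \<in> carrier_vec d" "y \<bullet> y = 1" "0 < y $ (d - 1)" using that cap_iff by auto
    then have "0 < (y $ (d - 1))\<^sup>2" by simp
    then have "proj_inv d y \<bullet> proj_inv d y < 1" using split[OF y(1)] y(2) by linarith
    then show ?thesis by (simp add: open_unit_ball_def proj_inv_def)
  qed
  show "bij_betw (proj d) (open_unit_ball (d - 1)) (cap d (pi / 2) (north_pole d))"
    by (rule bij_betw_byWitness[where f' = "proj_inv d"]) (use inv1 inv2 img img' in auto)
qed

text \<open>
  The matrix \<open>R\<close> is the chosen rotation taking \<open>y\<close> to the north pole; the space does not depend on
  the choice, and the statement quantifies over all of them.
\<close>

definition tangent_polys ::
    "nat \<Rightarrow> nat \<Rightarrow> real mat \<Rightarrow> real vec \<Rightarrow> (real vec \<Rightarrow> 'k::real_normed_field) set" where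
  "tangent_polys d L R y =
     {\<lambda>z\<in>cap d (pi / 2) y. p (proj_inv d (R *\<^sub>v z)) | p. p \<in> polys (d - 1) L}"

end

theory Submission
  imports Defs
begin

text \<open>
  Expressed in the coordinates of \<open>z\<close>, a tangent polynomial is a polynomial of degree at most \<open>L\<close> on
  \<open>\<real>\<^sup>d\<close>. It remains to write a homogeneous \<open>f\<close> of degree \<open>k\<close> on the sphere as a sum of harmonics. For
  explicit constants \<open>c\<^sub>j\<close> with \<open>c\<^sub>0 = 1\<close>, the polynomial \<open>h = \<Sum>\<^sub>j c\<^sub>j \<parallel>x\<parallel>\<^sup>2\<^sup>j \<Delta>\<^sup>j f\<close> is harmonic, and on
  the sphere \<open>f = h - \<Sum>\<^sub>j\<^sub>>\<^sub>0 c\<^sub>j \<Delta>\<^sup>j f\<close>, where the remaining terms have degree less than \<open>k\<close>.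
\<close>

text \<open>
  The last rule makes the notion depend on the values on \<open>carrier_vec d\<close> only; derivatives are
  uncontrolled elsewhere.
\<close>

inductive hom_poly :: "nat \<Rightarrow> nat \<Rightarrow> (real vec \<Rightarrow> 'k::real_normed_field) \<Rightarrow> bool" for d where
  const: "hom_poly d 0 (\<lambda>x. c)"
| zero: "hom_poly d k (\<lambda>x. 0)"
| add: "hom_poly d k f \<Longrightarrow> hom_poly d k g \<Longrightarrow> hom_poly d k (\<lambda>x. f x + g x)"
| coord: "hom_poly d k f \<Longrightarrow> i < d \<Longrightarrow> hom_poly d (Suc k) (\<lambda>x. of_real (x $ i) * f x)"
| cong: "hom_poly d k f \<Longrightarrow> (\<And>x. x \<in> carrier_vec d \<Longrightarrow> f x = g x) \<Longrightarrow> hom_poly d k g"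

lemma hom_poly_scale:
  assumes "hom_poly d k f"
  shows "hom_poly d k (\<lambda>x. c * f x)"
  using assms
proof induction
  case (const a)
  show ?case by (rule hom_poly.const)
next
  case (zero k)
  show ?case by (simp add: hom_poly.zero)
next
  case (add k f g)
  then show ?case by (simp add: distrib_left hom_poly.add)
next
  case (coord k f i)
  from hom_poly.coord[OF coord(3,2)] show ?case
    by (simp add: mult.left_commute)
next
  case (cong k f g)
  show ?case by (rule hom_poly.cong[OF cong(3)]) (simp add: cong)
qed

lemma hom_poly_sum:
  assumes "\<And>a. a \<in> A \<Longrightarrow> hom_poly d k (f a)"
  shows "hom_poly d k (\<lambda>x. \<Sum>a\<in>A. f a x)"
  using assms
  by (induction A rule: infinite_finite_induct) (simp_all add: hom_poly.zero hom_poly.add)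

subsection \<open>Derivatives\<close>

lemma has_derivative_coord:
  assumes "x \<in> carrier_vec d" "i < d" "j < d"
  shows "((\<lambda>t. of_real ((x + t \<cdot>\<^sub>v unit_vec d i) $ j) :: 'k::real_normed_field)
    has_vector_derivative (if i = j then 1 else 0)) (at 0)"
proof -
  have eq: "(\<lambda>t. of_real ((x + t \<cdot>\<^sub>v unit_vec d i) $ j) :: 'k) =
      (\<lambda>t. of_real (x $ j) + t *\<^sub>R (if i = j then 1 else 0))"
    using assms by (auto simp: scaleR_conv_of_real)
  show ?thesis unfolding eq
    by (auto intro!: derivative_eq_intros)
qed

lemma has_derivative_coord_mult:
  assumes "x \<in> carrier_vec d" "i < d" "j < d"
    and "((\<lambda>t. f (x + t \<cdot>\<^sub>v unit_vec d i)) has_vector_derivative f') (at 0)"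
  shows "((\<lambda>t. of_real ((x + t \<cdot>\<^sub>v unit_vec d i) $ j) * f (x + t \<cdot>\<^sub>v unit_vec d i) :: 'k::real_normed_field)
    has_vector_derivative of_real (x $ j) * f' + (if i = j then f x else 0)) (at 0)"
proof -
  have "x + 0 \<cdot>\<^sub>v unit_vec d i = x"
    using assms(1) by (intro eq_vecI) auto
  then show ?thesis
    by (intro has_vector_derivative_eq_rhs[OF has_vector_derivative_mult[OF has_derivative_coord[OF assms(1-3)] assms(4)]])
      simp
qed

lemma partial_deriv_cong:
  assumes "\<And>x. x \<in> carrier_vec d \<Longrightarrow> f x = g x" "x \<in> carrier_vec d"
  shows "partial_deriv d i f x = partial_deriv d i g x"
  using assms by (simp add: partial_deriv_def)

lemma laplacian_cong:
  assumes "\<And>x. x \<in> carrier_vec d \<Longrightarrow> f x = g x" "x \<in> carrier_vec d"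
  shows "laplacian d f x = laplacian d g x"
  unfolding laplacian_def
  by (intro sum.cong refl partial_deriv_cong assms)

text \<open>The last conjunct strengthens the induction. At \<open>k = 0\<close> the degree
  \<open>k - 1\<close> truncates, and in the \<open>coord\<close> case the product of a coordinate
  with the derivative has degree 0 only because that derivative vanishes.\<close>

lemma hom_poly_deriv_ex:
  assumes "hom_poly d k f" "i < d"
  shows "\<exists>g. (\<forall>x\<in>carrier_vec d.
      ((\<lambda>t. f (x + t \<cdot>\<^sub>v unit_vec d i)) has_vector_derivative g x) (at 0)) \<and>
    hom_poly d (k - 1) g \<and> (k = 0 \<longrightarrow> (\<forall>x\<in>carrier_vec d. g x = 0))"
  using assms
proof induction
  case (const a)
  show ?case by (rule exI[of _ "\<lambda>x. 0"]) (auto intro: hom_poly.zero)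
next
  case (zero k)
  show ?case by (rule exI[of _ "\<lambda>x. 0"]) (auto intro: hom_poly.zero)
next
  case (add k f g)
  from add.IH(1)[OF add.prems] obtain f' where f':
    "\<And>x. x \<in> carrier_vec d \<Longrightarrow> ((\<lambda>t. f (x + t \<cdot>\<^sub>v unit_vec d i)) has_vector_derivative f' x) (at 0)"
    "hom_poly d (k - 1) f'" "k = 0 \<Longrightarrow> \<forall>x\<in>carrier_vec d. f' x = 0" by blast
  from add.IH(2)[OF add.prems] obtain g' where g':
    "\<And>x. x \<in> carrier_vec d \<Longrightarrow> ((\<lambda>t. g (x + t \<cdot>\<^sub>v unit_vec d i)) has_vector_derivative g' x) (at 0)"
    "hom_poly d (k - 1) g'" "k = 0 \<Longrightarrow> \<forall>x\<in>carrier_vec d. g' x = 0" by blast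
  show ?case
    by (rule exI[of _ "\<lambda>x. f' x + g' x"])
      (use f' g' in \<open>auto intro: hom_poly.add has_vector_derivative_add\<close>)
next
  case (coord k f j)
  from coord.IH[OF coord.prems] obtain f' where f':
    "\<And>x. x \<in> carrier_vec d \<Longrightarrow> ((\<lambda>t. f (x + t \<cdot>\<^sub>v unit_vec d i)) has_vector_derivative f' x) (at 0)"
    "hom_poly d (k - 1) f'" "k = 0 \<Longrightarrow> \<forall>x\<in>carrier_vec d. f' x = 0" by blast
  \<comment> \<open>The conditional is a scalar factor here so that \<open>hom_poly_scale\<close>
    applies.\<close>
  let ?g = "\<lambda>x. of_real (x $ j) * f' x + (if i = j then 1 else 0) * f x"
  have "((\<lambda>t. of_real ((x + t \<cdot>\<^sub>v unit_vec d i) $ j) * f (x + t \<cdot>\<^sub>v unit_vec d i))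
      has_vector_derivative ?g x) (at 0)" if "x \<in> carrier_vec d" for x
    by (rule has_vector_derivative_eq_rhs[OF has_derivative_coord_mult[OF that coord.prems coord.hyps(2) f'(1)[OF that]]])
      simp
  moreover have "hom_poly d k (\<lambda>x. of_real (x $ j) * f' x)"
  proof (cases k)
    case 0
    show ?thesis by (rule hom_poly.cong[OF hom_poly.zero]) (use f'(3) 0 in auto)
  next
    case (Suc l)
    then show ?thesis using hom_poly.coord[OF f'(2) coord.hyps(2)] by simp
  qed
  then have "hom_poly d k ?g"
    by (intro hom_poly.add hom_poly_scale coord.hyps)
  ultimately show ?case by (intro exI[of _ ?g]) auto
next
  case (cong k f g)
  from cong.IH[OF cong.prems] show ?case
    using cong.hyps(2) by simp
qed

text \<open>Derivatives are unique, so on \<open>carrier_vec d\<close> the function from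
  \<open>hom_poly_deriv_ex\<close> is the partial derivative; rule \<open>cong\<close> then
  transfers homogeneity.\<close>

lemma
  assumes "hom_poly d k f" "i < d"
  shows hom_poly_has_deriv: "x \<in> carrier_vec d \<Longrightarrow>
      ((\<lambda>t. f (x + t \<cdot>\<^sub>v unit_vec d i)) has_vector_derivative partial_deriv d i f x) (at 0)"
    and hom_poly_partial_deriv: "hom_poly d (k - 1) (partial_deriv d i f)"
    and partial_deriv_degree_0: "k = 0 \<Longrightarrow> x \<in> carrier_vec d \<Longrightarrow> partial_deriv d i f x = 0"
proof -
  obtain g where g: "\<And>x. x \<in> carrier_vec d \<Longrightarrow>
      ((\<lambda>t. f (x + t \<cdot>\<^sub>v unit_vec d i)) has_vector_derivative g x) (at 0)"
    "hom_poly d (k - 1) g" "k = 0 \<Longrightarrow> \<forall>x\<in>carrier_vec d. g x = 0"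
    using hom_poly_deriv_ex[OF assms] by blast
  have eq: "partial_deriv d i f x = g x" if "x \<in> carrier_vec d" for x
    unfolding partial_deriv_def by (rule vector_derivative_at[OF g(1)[OF that]])
  show "((\<lambda>t. f (x + t \<cdot>\<^sub>v unit_vec d i)) has_vector_derivative partial_deriv d i f x) (at 0)"
    if "x \<in> carrier_vec d" using g(1)[OF that] eq[OF that] by simp
  show "hom_poly d (k - 1) (partial_deriv d i f)"
    by (rule hom_poly.cong[OF g(2)]) (simp add: eq)
  show "k = 0 \<Longrightarrow> x \<in> carrier_vec d \<Longrightarrow> partial_deriv d i f x = 0"
    using g(3) eq by simp
qed

text \<open>Homogeneity supplies differentiability. Two independent degrees cover
  \<open>laplacian_coord\<close> at \<open>k = 0\<close>, where truncation assigns different degrees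
  to the two summands.\<close>

lemma partial_deriv_add:
  assumes "hom_poly d k f" "hom_poly d l g" "i < d" "x \<in> carrier_vec d"
  shows "partial_deriv d i (\<lambda>x. f x + g x) x = partial_deriv d i f x + partial_deriv d i g x"
  by (subst partial_deriv_def, rule vector_derivative_at)
    (intro has_vector_derivative_add hom_poly_has_deriv[OF assms(1)] hom_poly_has_deriv[OF assms(2)] assms)

lemma partial_deriv_scale:
  assumes "hom_poly d k f" "i < d" "x \<in> carrier_vec d"
  shows "partial_deriv d i (\<lambda>x. c * f x) x = c * partial_deriv d i f x"
  by (subst partial_deriv_def, rule vector_derivative_at)
    (rule has_vector_derivative_mult_right[OF hom_poly_has_deriv[OF assms]])

lemma partial_deriv_coord:
  assumes "hom_poly d k f" "i < d" "j < d" "x \<in> carrier_vec d"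
  shows "partial_deriv d i (\<lambda>x. of_real (x $ j) * f x) x =
    of_real (x $ j) * partial_deriv d i f x + (if i = j then f x else 0)"
  by (subst partial_deriv_def, rule vector_derivative_at)
    (rule has_derivative_coord_mult[OF assms(4,2,3) hom_poly_has_deriv[OF assms(1,2,4)]])

text \<open>In the induction, the product rule for a new coordinate factor adds one copy of the
  product itself, raising the factor from \<open>k\<close> to \<open>Suc k\<close>.\<close>

lemma euler_identity:
  assumes "hom_poly d k f" "x \<in> carrier_vec d"
  shows "(\<Sum>i<d. of_real (x $ i) * partial_deriv d i f x) = of_nat k * f x"
  using assms(1)
proof induction
  case (const a)
  show ?case
    by (rule trans[OF sum.neutral])
      (simp_all add: partial_deriv_degree_0[OF hom_poly.const _ refl assms(2)])
next
  case (zero k)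
  have "partial_deriv d i (\<lambda>x. 0 :: 'a) x = 0" if "i < d" for i
    using partial_deriv_degree_0[OF hom_poly.const that refl assms(2)] .
  then show ?case by simp
next
  case (add k f g)
  then show ?case
    by (simp add: partial_deriv_add[OF add.hyps _ assms(2)] distrib_left sum.distrib)
next
  case (coord k f j)
  have "(\<Sum>i<d. of_real (x $ i) * partial_deriv d i (\<lambda>x. of_real (x $ j) * f x) x) =
     (\<Sum>i<d. of_real (x $ j) * (of_real (x $ i) * partial_deriv d i f x) + (if i = j then of_real (x $ i) * f x else 0))"
    using coord.hyps assms(2) by (intro sum.cong refl) (simp add: partial_deriv_coord distrib_left mult.left_commute)
  also have "\<dots> = of_real (x $ j) * (of_nat k * f x) + of_real (x $ j) * f x"
    using coord by (simp add: sum.distrib flip: sum_distrib_left)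
  finally show ?case by (simp add: algebra_simps)
next
  case (cong k f g)
  then show ?case
    using assms(2) partial_deriv_cong[of d f g x] by simp
qed

lemma hom_poly_laplacian:
  assumes "hom_poly d k f"
  shows "hom_poly d (k - 2) (laplacian d f)"
  unfolding laplacian_def
proof (rule hom_poly_sum)
  show "hom_poly d (k - 2) (partial_deriv d i (partial_deriv d i f))" if "i \<in> {..<d}" for i
    using hom_poly_partial_deriv[OF hom_poly_partial_deriv[OF assms]] that
    by (simp add: numeral_2_eq_2)
qed

text \<open>Covers the degrees in which \<open>k - 2\<close> truncates in
  \<open>hom_poly_laplacian\<close>; it removes the last term of the telescoping sum below.\<close>

lemma laplacian_degree_less_2:
  assumes "hom_poly d k f" "k < 2" "x \<in> carrier_vec d"
  shows "laplacian d f x = 0"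
  unfolding laplacian_def
proof (rule sum.neutral, safe)
  show "partial_deriv d i (partial_deriv d i f) x = 0" if "i < d" for i
    using partial_deriv_degree_0[OF hom_poly_partial_deriv[OF assms(1)]] that assms by simp
qed

lemma laplacian_add:
  assumes "hom_poly d k f" "hom_poly d l g" "x \<in> carrier_vec d"
  shows "laplacian d (\<lambda>x. f x + g x) x = laplacian d f x + laplacian d g x"
proof -
  have "partial_deriv d i (partial_deriv d i (\<lambda>x. f x + g x)) x =
      partial_deriv d i (partial_deriv d i f) x + partial_deriv d i (partial_deriv d i g) x"
    if "i < d" for i
  proof -
    \<comment> \<open>The inner identity holds on \<open>carrier_vec d\<close> only, which suffices
      because the line of differentiation stays in that set.\<close>
    have "partial_deriv d i (partial_deriv d i (\<lambda>x. f x + g x)) x =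
        partial_deriv d i (\<lambda>x. partial_deriv d i f x + partial_deriv d i g x) x"
      by (rule partial_deriv_cong) (simp_all add: partial_deriv_add[OF assms(1,2) that] assms(3))
    then show ?thesis
      using partial_deriv_add[OF hom_poly_partial_deriv hom_poly_partial_deriv] assms that by metis
  qed
  then show ?thesis by (simp add: laplacian_def sum.distrib)
qed

lemma laplacian_scale:
  assumes "hom_poly d k f" "x \<in> carrier_vec d"
  shows "laplacian d (\<lambda>x. c * f x) x = c * laplacian d f x"
proof -
  have "partial_deriv d i (partial_deriv d i (\<lambda>x. c * f x)) x =
      c * partial_deriv d i (partial_deriv d i f) x" if "i < d" for i
  proof -
    have "partial_deriv d i (partial_deriv d i (\<lambda>x. c * f x)) x =
        partial_deriv d i (\<lambda>x. c * partial_deriv d i f x) x"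
      by (rule partial_deriv_cong) (simp_all add: partial_deriv_scale[OF assms(1) that] assms(2))
    then show ?thesis
      using partial_deriv_scale[OF hom_poly_partial_deriv] assms that by metis
  qed
  then show ?thesis by (simp add: laplacian_def sum_distrib_left)
qed

lemma laplacian_sum:
  assumes "\<And>a. a \<in> A \<Longrightarrow> hom_poly d k (f a)" "x \<in> carrier_vec d"
  shows "laplacian d (\<lambda>x. \<Sum>a\<in>A. f a x) x = (\<Sum>a\<in>A. laplacian d (f a) x)"
  using assms(1)
proof (induction A rule: infinite_finite_induct)
  case (insert a A)
  then show ?case
    using laplacian_add[of d k "f a" k "\<lambda>x. \<Sum>a\<in>A. f a x"] assms(2)
    by (simp add: hom_poly_sum)
qed (use laplacian_degree_less_2[OF hom_poly.zero[of d 0] _ assms(2)] in auto)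

text \<open>The commutator of the Laplacian with a coordinate: applying the product rule twice
  leaves two equal extra terms, in direction \<open>i = j\<close> only.\<close>

lemma laplacian_coord:
  assumes "hom_poly d k f" "j < d" "x \<in> carrier_vec d"
  shows "laplacian d (\<lambda>x. of_real (x $ j) * f x) x =
    of_real (x $ j) * laplacian d f x + 2 * partial_deriv d j f x"
proof -
  have "partial_deriv d i (partial_deriv d i (\<lambda>x. of_real (x $ j) * f x)) x =
      of_real (x $ j) * partial_deriv d i (partial_deriv d i f) x +
        (if i = j then 2 * partial_deriv d i f x else 0)" if "i < d" for i
  proof -
    let ?D = "partial_deriv d i f"
    have h: "hom_poly d (k - 1) ?D" by (rule hom_poly_partial_deriv[OF assms(1) that])
    have "partial_deriv d i (partial_deriv d i (\<lambda>x. of_real (x $ j) * f x)) x =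
        partial_deriv d i (\<lambda>x. of_real (x $ j) * ?D x + (if i = j then 1 else 0) * f x) x"
      by (rule partial_deriv_cong) (use assms that in \<open>simp_all add: partial_deriv_coord\<close>)
    also have "\<dots> = partial_deriv d i (\<lambda>x. of_real (x $ j) * ?D x) x + (if i = j then 1 else 0) * ?D x"
      by (subst partial_deriv_add[OF hom_poly.coord[OF h assms(2)] hom_poly_scale[OF assms(1)] that assms(3)],
          subst partial_deriv_scale[OF assms(1) that assms(3)]) simp
    also have "\<dots> = of_real (x $ j) * partial_deriv d i ?D x + (if i = j then 2 * ?D x else 0)"
      by (simp add: partial_deriv_coord[OF h that assms(2,3)])
    finally show ?thesis .
  qed
  then show ?thesis using assms(2)
    by (simp add: laplacian_def sum.distrib sum_distrib_left)
qed

subsection \<open>Harmonic projection\<close>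

lemma scalar_prod_self:
  "(x :: real vec) \<in> carrier_vec d \<Longrightarrow> x \<bullet> x = (\<Sum>i<d. x $ i * x $ i)"
  by (simp add: scalar_prod_def atLeast0LessThan)

text \<open>The nested products let rule \<open>coord\<close> and lemma
  \<open>laplacian_coord\<close> be applied twice to each summand.\<close>

lemma norm_sq_mult_eq:
  assumes "x \<in> carrier_vec d"
  shows "of_real (x \<bullet> x) * c = (\<Sum>i<d. of_real (x $ i) * (of_real (x $ i) * (c :: 'k::real_normed_field)))"
  by (simp add: scalar_prod_self[OF assms] sum_distrib_right mult.assoc)

lemma hom_poly_norm_sq_mult:
  assumes "hom_poly d k f"
  shows "hom_poly d (k + 2) (\<lambda>x. of_real (x \<bullet> x) * f x)"
proof (rule hom_poly.cong)
  show "hom_poly d (k + 2) (\<lambda>x. \<Sum>i<d. of_real (x $ i) * (of_real (x $ i) * f x))"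
    by (rule hom_poly_sum) (use hom_poly.coord[OF hom_poly.coord[OF assms]] in auto)
qed (simp add: norm_sq_mult_eq)

text \<open>For each \<open>i\<close>, two uses of \<open>laplacian_coord\<close> leave 4 times
  \<open>x $ i\<close> times the partial derivative, plus 2 times \<open>f x\<close>. Summing over
  \<open>i\<close> and using Euler's identity yields the factors \<open>4 * k\<close> and
  \<open>2 * d\<close>.\<close>

lemma laplacian_norm_sq_mult:
  assumes "hom_poly d k f" "x \<in> carrier_vec d"
  shows "laplacian d (\<lambda>x. of_real (x \<bullet> x) * f x) x =
    of_real (x \<bullet> x) * laplacian d f x + of_nat (2 * d + 4 * k) * f x"
proof -
  have "laplacian d (\<lambda>x. of_real (x \<bullet> x) * f x) x =
      laplacian d (\<lambda>x. \<Sum>i<d. of_real (x $ i) * (of_real (x $ i) * f x)) x"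
    by (rule laplacian_cong) (simp_all add: norm_sq_mult_eq assms)
  also have "\<dots> = (\<Sum>i<d. laplacian d (\<lambda>x. of_real (x $ i) * (of_real (x $ i) * f x)) x)"
    by (rule laplacian_sum[OF _ assms(2)]) (use hom_poly.coord[OF hom_poly.coord[OF assms(1)]] in auto)
  also have "\<dots> = (\<Sum>i<d. of_real (x $ i) * (of_real (x $ i) * laplacian d f x) +
      (4 * (of_real (x $ i) * partial_deriv d i f x) + 2 * f x))"
    using assms by (intro sum.cong refl)
      (simp add: laplacian_coord[OF hom_poly.coord[OF assms(1)]] laplacian_coord partial_deriv_coord,
       simp add: algebra_simps)
  also have "\<dots> = of_real (x \<bullet> x) * laplacian d f x + (4 * (of_nat k * f x) + of_nat d * (2 * f x))"
    unfolding sum.distrib sum_distrib_left[symmetric] euler_identity[OF assms]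
    by (simp add: norm_sq_mult_eq[OF assms(2)] sum_distrib_left)
  finally show ?thesis by (simp add: algebra_simps)
qed

lemma hom_poly_norm_sq_pow_mult:
  assumes "hom_poly d k f"
  shows "hom_poly d (k + 2 * j) (\<lambda>x. of_real (x \<bullet> x) ^ j * f x)"
proof (induction j)
  case (Suc j)
  from hom_poly_norm_sq_mult[OF this] show ?case by (simp add: mult.assoc)
qed (simp add: assms)

text \<open>The factor is the sum of \<open>2 * d + 4 * (k + 2 * i)\<close> over
  \<open>i \<le> j\<close>: each new squared norm multiplies a polynomial of degree
  \<open>k + 2 * i\<close>. Writing the exponent as \<open>Suc j\<close> avoids truncated
  subtraction.\<close>

lemma laplacian_norm_sq_pow_mult:
  assumes "hom_poly d k f" "x \<in> carrier_vec d"
  shows "laplacian d (\<lambda>x. of_real (x \<bullet> x) ^ Suc j * f x) x =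
    of_real (x \<bullet> x) ^ Suc j * laplacian d f x +
    of_nat (2 * Suc j * (d + 2 * k + 2 * j)) * (of_real (x \<bullet> x) ^ j * f x)"
proof (induction j)
  case 0
  from laplacian_norm_sq_mult[OF assms] show ?case by (simp add: algebra_simps)
next
  case (Suc j)
  from laplacian_norm_sq_mult[OF hom_poly_norm_sq_pow_mult[OF assms(1), of "Suc j"] assms(2)]
  show ?case by (simp only: mult.assoc power_Suc[of _ "Suc j"] Suc) (simp add: algebra_simps)
qed

lemma hom_poly_laplacian_pow:
  assumes "hom_poly d k f"
  shows "hom_poly d (k - 2 * j) ((laplacian d ^^ j) f)"
proof (induction j)
  case (Suc j)
  from hom_poly_laplacian[OF this] show ?case by simp
qed (simp add: assms)

text \<open>
  By \<open>\<Delta>(\<parallel>x\<parallel>\<^sup>2\<^sup>j g) = \<parallel>x\<parallel>\<^sup>2\<^sup>j \<Delta>g + 2j(d + 2 deg g + 2j - 2) \<parallel>x\<parallel>\<^sup>2\<^sup>j\<^sup>-\<^sup>2 g\<close>, applied to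
  \<open>g = \<Delta>\<^sup>j f\<close> of degree \<open>k - 2j\<close>, these coefficients make \<open>\<Delta>(\<Sum>\<^sub>j c\<^sub>j \<parallel>x\<parallel>\<^sup>2\<^sup>j \<Delta>\<^sup>j f)\<close> telescope.
\<close>

definition harmonic_coeff :: "nat \<Rightarrow> nat \<Rightarrow> nat \<Rightarrow> real" where
  "harmonic_coeff d k j = (\<Prod>i<j. - 1 / real (2 * Suc i * (d + 2 * (k - 2 * Suc i) + 2 * i)))"

text \<open>The cutoff \<open>n\<close> is a parameter so that the telescoping can be proved by
  induction on it; \<open>n = k div 2\<close> gives the harmonic polynomial.\<close>

definition harmonic_part :: "nat \<Rightarrow> nat \<Rightarrow> nat \<Rightarrow> (real vec \<Rightarrow> 'k::real_normed_field) \<Rightarrow> real vec \<Rightarrow> 'k" where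
  "harmonic_part d k n f x =
    (\<Sum>j\<le>n. of_real (harmonic_coeff d k j) * (of_real (x \<bullet> x) ^ j * (laplacian d ^^ j) f x))"

text \<open>The bound on \<open>j\<close> keeps \<open>k - 2 * j\<close> from truncating, so the
  power of the squared norm restores degree \<open>k\<close> exactly.\<close>

lemma hom_poly_harmonic_summand:
  assumes "hom_poly d k f" "2 * j \<le> k"
  shows "hom_poly d k (\<lambda>x. of_real (harmonic_coeff d k j) *
    (of_real (x \<bullet> x) ^ j * (laplacian d ^^ j) f x))"
  using hom_poly_scale[OF hom_poly_norm_sq_pow_mult[OF hom_poly_laplacian_pow[OF assms(1), of j], of j]] assms(2)
  by simp

lemma hom_poly_harmonic_part:
  assumes "hom_poly d k f" "2 * n \<le> k"
  shows "hom_poly d k (harmonic_part d k n f)"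
  unfolding harmonic_part_def
  by (rule hom_poly_sum, rule hom_poly_harmonic_summand) (use assms in auto)

text \<open>Each summand yields a term with one more Laplacian and a term with one less squared
  norm. The latter cancels the former from the preceding summand, so only the former from the last
  summand survives.\<close>

lemma laplacian_harmonic_part:
  assumes "hom_poly d k f" "2 * n \<le> k" "d > 0" "x \<in> carrier_vec d"
  shows "laplacian d (harmonic_part d k n f) x =
    of_real (harmonic_coeff d k n) * (of_real (x \<bullet> x) ^ n * (laplacian d ^^ Suc n) f x)"
  using assms(2)
proof (induction n)
  case 0
  show ?case by (simp add: harmonic_part_def[abs_def] harmonic_coeff_def)
next
  case (Suc n)
  let ?c = "\<lambda>j. of_real (harmonic_coeff d k j) :: 'a"
  let ?r = "of_real (x \<bullet> x) :: 'a"
  \<comment> \<open>The factor in \<open>laplacian_norm_sq_pow_mult\<close> for degree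
    \<open>k - 2 * Suc n\<close> and exponent \<open>Suc n\<close>.\<close>
  let ?a = "2 * Suc n * (d + 2 * (k - 2 * Suc n) + 2 * n)"
  let ?T = "\<lambda>x. of_real (x \<bullet> x) ^ Suc n * (laplacian d ^^ Suc n) f x"
  have "harmonic_coeff d k (Suc n) = harmonic_coeff d k n * (- 1 / real ?a)"
    by (simp add: harmonic_coeff_def)
  \<comment> \<open>Positivity of \<open>d\<close> keeps the denominator nonzero even if
    \<open>n\<close> and the remaining degree are 0.\<close>
  moreover have "real ?a \<noteq> 0"
    using assms(3) by (simp only: of_nat_eq_0_iff) simp
  ultimately have "harmonic_coeff d k (Suc n) * real ?a = - harmonic_coeff d k n"
    by (simp only: mult.assoc) simp
  then have c: "?c (Suc n) * of_nat ?a = - ?c n"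
    by (metis of_real_minus of_real_mult of_real_of_nat_eq)
  have f': "hom_poly d (k - 2 * Suc n) ((laplacian d ^^ Suc n) f)"
    by (rule hom_poly_laplacian_pow[OF assms(1)])
  have T: "hom_poly d k ?T"
    using hom_poly_norm_sq_pow_mult[OF f', of "Suc n"] by (simp only: le_add_diff_inverse2[OF Suc.prems])
  have n: "hom_poly d k (harmonic_part d k n f)"
    using hom_poly_harmonic_part[OF assms(1), of n] Suc.prems by simp
  have "laplacian d (harmonic_part d k (Suc n) f) x =
      laplacian d (\<lambda>x. harmonic_part d k n f x + ?c (Suc n) * ?T x) x"
    by (simp only: harmonic_part_def[abs_def] sum.atMost_Suc)
  also have "\<dots> = laplacian d (harmonic_part d k n f) x + ?c (Suc n) * laplacian d ?T x"
    unfolding laplacian_add[OF n hom_poly_scale[OF T] assms(4)] laplacian_scale[OF T assms(4)] ..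
  also have "laplacian d ?T x = ?r ^ Suc n * (laplacian d ^^ Suc (Suc n)) f x +
      of_nat ?a * (?r ^ n * (laplacian d ^^ Suc n) f x)"
    using laplacian_norm_sq_pow_mult[OF f' assms(4)] by simp
  also have "?c (Suc n) * \<dots> = ?c (Suc n) * (?r ^ Suc n * (laplacian d ^^ Suc (Suc n)) f x) +
      (?c (Suc n) * of_nat ?a) * (?r ^ n * (laplacian d ^^ Suc n) f x)"
    by (simp only: distrib_left mult.assoc)
  also have "laplacian d (harmonic_part d k n f) x =
      ?c n * (?r ^ n * (laplacian d ^^ Suc n) f x)"
    using Suc by simp
  finally show ?case unfolding c by (simp only: mult_minus_left) simp
qed

text \<open>After \<open>k div 2\<close> Laplacians the degree is \<open>k mod 2\<close>, below 2,
  so one more Laplacian annihilates the surviving term.\<close>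

lemma laplacian_harmonic_part_eq_0:
  assumes "hom_poly d k f" "d > 0" "x \<in> carrier_vec d"
  shows "laplacian d (harmonic_part d k (k div 2) f) x = 0"
proof -
  have "(laplacian d ^^ Suc (k div 2)) f x = 0"
    using laplacian_degree_less_2[OF hom_poly_laplacian_pow[OF assms(1), of "k div 2"] _ assms(3)]
    by (simp add: minus_mult_div_eq_mod)
  then show ?thesis
    using laplacian_harmonic_part[OF assms(1) _ assms(2,3), of "k div 2"] by simp
qed

subsection \<open>Coefficient representation\<close>

lemma homogeneous_polys_add:
  assumes "restrict f (carrier_vec d) \<in> homogeneous_polys d k"
    and "restrict g (carrier_vec d) \<in> homogeneous_polys d k"
  shows "restrict (\<lambda>x. f x + g x) (carrier_vec d) \<in> homogeneous_polys d k"
proof -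
  let ?A = "{\<alpha>. length \<alpha> = d \<and> sum_list \<alpha> = k}"
  obtain a b where
    a: "restrict f (carrier_vec d) = (\<lambda>x\<in>carrier_vec d. \<Sum>\<alpha>\<in>?A. a \<alpha> * of_real (monomial_fun \<alpha> x))" and
    b: "restrict g (carrier_vec d) = (\<lambda>x\<in>carrier_vec d. \<Sum>\<alpha>\<in>?A. b \<alpha> * of_real (monomial_fun \<alpha> x))"
    using assms by (auto simp: homogeneous_polys_def)
  have "f x = (\<Sum>\<alpha>\<in>?A. a \<alpha> * of_real (monomial_fun \<alpha> x))"
    "g x = (\<Sum>\<alpha>\<in>?A. b \<alpha> * of_real (monomial_fun \<alpha> x))" if "x \<in> carrier_vec d" for x
    using fun_cong[OF a, of x] fun_cong[OF b, of x] that by simp_all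
  then have "restrict (\<lambda>x. f x + g x) (carrier_vec d) =
      (\<lambda>x\<in>carrier_vec d. \<Sum>\<alpha>\<in>?A. (a \<alpha> + b \<alpha>) * of_real (monomial_fun \<alpha> x))"
    by (auto simp: sum.distrib distrib_right)
  then show ?thesis unfolding homogeneous_polys_def
    by (intro CollectI exI[of _ "\<lambda>\<alpha>. a \<alpha> + b \<alpha>"]) simp
qed

lemma homogeneous_polys_zero:
  "restrict (\<lambda>x. 0) (carrier_vec d) \<in> homogeneous_polys d k"
  unfolding homogeneous_polys_def by (intro CollectI exI[of _ "\<lambda>_. 0"]) simp

lemma homogeneous_polys_sum:
  assumes "\<And>a. a \<in> A \<Longrightarrow> restrict (f a) (carrier_vec d) \<in> homogeneous_polys d k"
  shows "restrict (\<lambda>x. \<Sum>a\<in>A. f a x) (carrier_vec d) \<in> homogeneous_polys d k"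
  using assms
  by (induction A rule: infinite_finite_induct)
    (simp_all add: homogeneous_polys_zero homogeneous_polys_add)

lemma homogeneous_polys_monomial:
  assumes "length \<beta> = d" "sum_list \<beta> = k"
  shows "restrict (\<lambda>x. c * of_real (monomial_fun \<beta> x)) (carrier_vec d) \<in> homogeneous_polys d k"
proof -
  have "(\<Sum>\<alpha> | length \<alpha> = d \<and> sum_list \<alpha> = k.
      (if \<alpha> = \<beta> then c else 0) * of_real (monomial_fun \<alpha> x)) = c * of_real (monomial_fun \<beta> x)" for x
    using assms by (subst sum.remove[OF finite_multi_indices(2), of \<beta>]) (auto intro: sum.neutral)
  then show ?thesis unfolding homogeneous_polys_def
    by (intro CollectI exI[of _ "\<lambda>\<alpha>. if \<alpha> = \<beta> then c else 0"]) (auto simp only:)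
qed

lemma monomial_fun_update:
  assumes "i < length \<alpha>"
  shows "monomial_fun (\<alpha>[i := Suc (\<alpha> ! i)]) x = x $ i * monomial_fun \<alpha> x"
proof -
  show ?thesis
    unfolding monomial_fun_def length_list_update
    using assms by (simp add: prod.remove[of "{..<length \<alpha>}" i] mult.assoc)
qed

lemma sum_list_update_Suc:
  "i < length \<alpha> \<Longrightarrow> sum_list (\<alpha>[i := Suc (\<alpha> ! i)]) = Suc (sum_list \<alpha>)"
  by (induction \<alpha> arbitrary: i) (auto split: nat.splits)

lemma homogeneous_polys_coord:
  assumes "restrict f (carrier_vec d) \<in> homogeneous_polys d k" "i < d"
  shows "restrict (\<lambda>x. of_real (x $ i) * f x) (carrier_vec d) \<in> homogeneous_polys d (Suc k)"
proof -
  let ?A = "{\<alpha>. length \<alpha> = d \<and> sum_list \<alpha> = k}"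
  let ?u = "\<lambda>\<alpha>. \<alpha>[i := Suc (\<alpha> ! i)]"
  obtain a where
    a: "restrict f (carrier_vec d) = (\<lambda>x\<in>carrier_vec d. \<Sum>\<alpha>\<in>?A. a \<alpha> * of_real (monomial_fun \<alpha> x))"
    using assms by (auto simp: homogeneous_polys_def)
  have "f x = (\<Sum>\<alpha>\<in>?A. a \<alpha> * of_real (monomial_fun \<alpha> x))" if "x \<in> carrier_vec d" for x
    using fun_cong[OF a, of x] that by simp
  \<comment> \<open>Each shifted monomial is kept as a separate summand, so the coefficients need
    not be reindexed along the shift of multi-indices.\<close>
  then have eq: "restrict (\<lambda>x. of_real (x $ i) * f x) (carrier_vec d) =
      (\<lambda>x\<in>carrier_vec d. \<Sum>\<alpha>\<in>?A. a \<alpha> * of_real (monomial_fun (?u \<alpha>) x))"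
    using assms(2)
    by (auto simp: sum_distrib_left monomial_fun_update mult.left_commute intro!: ext sum.cong)
  show ?thesis unfolding eq
    by (rule homogeneous_polys_sum, rule homogeneous_polys_monomial)
      (use assms(2) sum_list_update_Suc in auto)
qed

text \<open>Connects the inductive predicate with the coefficient sums underlying
  \<open>Harm\<close>; the closure properties above match its rules.\<close>

lemma hom_poly_imp_homogeneous_polys:
  assumes "hom_poly d k f"
  shows "restrict f (carrier_vec d) \<in> homogeneous_polys d k"
  using assms
proof induction
  case (const c)
  show ?case
    using homogeneous_polys_monomial[of "replicate d 0" d 0 c]
    by (simp add: monomial_fun_def sum_list_replicate restrict_def)
next
  case (zero k)
  show ?case by (rule homogeneous_polys_zero)
next
  case (add k f g)
  from add.IH show ?case by (rule homogeneous_polys_add)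
next
  case (coord k f i)
  from coord.IH coord.hyps(2) show ?case by (rule homogeneous_polys_coord)
next
  case (cong k f g)
  have "restrict g (carrier_vec d) = restrict f (carrier_vec d)"
    using cong.hyps(2) by (auto intro!: restrict_ext)
  then show ?case using cong.IH by simp
qed

subsection \<open>Restrictions to the sphere\<close>

text \<open>\<open>Harm\<close> asks for an extensional polynomial. Restricting to
  \<open>carrier_vec d\<close> leaves the Laplacian there unchanged.\<close>

lemma harmonic_hom_poly_in_Harm:
  assumes "hom_poly d k f" "\<And>x. x \<in> carrier_vec d \<Longrightarrow> laplacian d f x = 0"
  shows "restrict f (unit_sphere d) \<in> Harm d k"
proof -
  have "laplacian d (restrict f (carrier_vec d)) x = 0" if "x \<in> carrier_vec d" for x
    using laplacian_cong[of d "restrict f (carrier_vec d)" f x] assms(2) that by simp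
  moreover have "restrict f (unit_sphere d) = restrict (restrict f (carrier_vec d)) (unit_sphere d)"
    by (auto simp: unit_sphere_def restrict_def)
  ultimately show ?thesis
    unfolding Harm_def using hom_poly_imp_homogeneous_polys[OF assms(1)] by blast
qed

text \<open>Membership in the sum of harmonic spaces, up to equality on the sphere. Unrestricted
  components make sums and scalar multiples direct.\<close>

definition spherical_hom :: "nat \<Rightarrow> nat \<Rightarrow> (real vec \<Rightarrow> 'k::real_normed_field) \<Rightarrow> bool" where
  "spherical_hom d L f \<longleftrightarrow> (\<exists>h. (\<forall>k\<le>L. hom_poly d k (h k) \<and> (\<forall>x\<in>carrier_vec d. laplacian d (h k) x = 0)) \<and>
     (\<forall>z\<in>unit_sphere d. f z = (\<Sum>k\<le>L. h k z)))"

lemma spherical_hom_add: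
  assumes "spherical_hom d L f" "spherical_hom d L g"
  shows "spherical_hom d L (\<lambda>x. f x + g x)"
proof -
  obtain a where a: "\<And>k. k \<le> L \<Longrightarrow> hom_poly d k (a k)"
     "\<And>k x. k \<le> L \<Longrightarrow> x\<in>carrier_vec d \<Longrightarrow> laplacian d (a k) x = 0"
     "\<And>z. z\<in>unit_sphere d \<Longrightarrow> f z = (\<Sum>k\<le>L. a k z)"
    using assms(1) unfolding spherical_hom_def by blast
  obtain b where b: "\<And>k. k \<le> L \<Longrightarrow> hom_poly d k (b k)"
     "\<And>k x. k \<le> L \<Longrightarrow> x\<in>carrier_vec d \<Longrightarrow> laplacian d (b k) x = 0"
     "\<And>z. z\<in>unit_sphere d \<Longrightarrow> g z = (\<Sum>k\<le>L. b k z)"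
    using assms(2) unfolding spherical_hom_def by blast
  show ?thesis unfolding spherical_hom_def
    by (rule exI[of _ "\<lambda>k x. a k x + b k x"])
      (use a b in \<open>auto intro: hom_poly.add simp: sum.distrib laplacian_add[OF a(1) b(1)]\<close>)
qed

lemma spherical_hom_scale:
  assumes "spherical_hom d L f"
  shows "spherical_hom d L (\<lambda>x. c * f x)"
proof -
  obtain a where a: "\<And>k. k \<le> L \<Longrightarrow> hom_poly d k (a k)"
     "\<And>k x. k \<le> L \<Longrightarrow> x\<in>carrier_vec d \<Longrightarrow> laplacian d (a k) x = 0"
     "\<And>z. z\<in>unit_sphere d \<Longrightarrow> f z = (\<Sum>k\<le>L. a k z)"
    using assms(1) unfolding spherical_hom_def by blast
  show ?thesis unfolding spherical_hom_def
    by (rule exI[of _ "\<lambda>k x. c * a k x"])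
      (use a in \<open>auto intro: hom_poly_scale simp: sum_distrib_left laplacian_scale[OF a(1)]\<close>)
qed

lemma spherical_hom_harmonic:
  assumes "hom_poly d k f" "\<And>x. x \<in> carrier_vec d \<Longrightarrow> laplacian d f x = 0" "k \<le> L"
  shows "spherical_hom d L f"
  unfolding spherical_hom_def
proof (intro exI[of _ "\<lambda>l x. if l = k then f x else 0"] conjI allI impI ballI)
  show "hom_poly d l (\<lambda>x. if l = k then f x else 0)" for l
    using assms(1) by (cases "l = k") (auto intro: hom_poly.zero)
  show "laplacian d (\<lambda>x. if l = k then f x else 0) x = 0" if "x \<in> carrier_vec d" for l x
    using assms(2)[OF that] laplacian_degree_less_2[OF hom_poly.zero[of d 0] _ that]
    by (cases "l = k") auto
  show "f z = (\<Sum>l\<le>L. if l = k then f z else 0)" for z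
    using assms(3) by simp
qed

lemma spherical_hom_sum:
  fixes f :: "'a \<Rightarrow> real vec \<Rightarrow> 'k::real_normed_field"
  assumes "\<And>a. a \<in> A \<Longrightarrow> spherical_hom d L (f a)"
  shows "spherical_hom d L (\<lambda>x. \<Sum>a\<in>A. f a x)"
proof -
  have "spherical_hom d L (\<lambda>x. 0 :: 'k)"
    by (rule spherical_hom_harmonic[OF hom_poly.zero[of d 0]])
      (simp_all add: laplacian_degree_less_2[OF hom_poly.zero[of d 0]])
  then show ?thesis using assms
    by (induction A rule: infinite_finite_induct) (simp_all add: spherical_hom_add)
qed

lemma spherical_hom_cong:
  assumes "spherical_hom d L f" "\<And>z. z \<in> unit_sphere d \<Longrightarrow> f z = g z"
  shows "spherical_hom d L g"
  using assms unfolding spherical_hom_def by simp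

lemma unit_sphere_iff: "z \<in> unit_sphere d \<longleftrightarrow> z \<in> carrier_vec d \<and> z \<bullet> z = 1"
  by (simp add: unit_sphere_def)

text \<open>Strong induction on \<open>k\<close> with \<open>L\<close> fixed: on the sphere,
  \<open>f\<close> differs from its harmonic part only by multiples of iterated Laplacians.\<close>

lemma hom_poly_spherical_hom:
  assumes "hom_poly d k f" "k \<le> L" "d > 0"
  shows "spherical_hom d L f"
  using assms(1,2)
proof (induction k arbitrary: f rule: less_induct)
  case (less k)
  let ?n = "k div 2"
  let ?h = "harmonic_part d k ?n f"
  let ?g = "\<lambda>x. \<Sum>j\<in>{1..?n}. - of_real (harmonic_coeff d k j) * (laplacian d ^^ j) f x"
  have "spherical_hom d L ?h"
    by (rule spherical_hom_harmonic[OF hom_poly_harmonic_part[OF less.prems(1)] _ less.prems(2)])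
      (simp_all add: laplacian_harmonic_part_eq_0[OF less.prems(1) assms(3)])
  moreover have "spherical_hom d L ?g"
  proof (intro spherical_hom_sum spherical_hom_scale)
    \<comment> \<open>Here \<open>1 \<le> j \<le> k div 2\<close>, so \<open>k - 2 * j\<close> is
      strictly below \<open>k\<close> and the induction hypothesis applies.\<close>
    show "spherical_hom d L ((laplacian d ^^ j) f)" if "j \<in> {1..?n}" for j
      by (rule less.IH[OF _ hom_poly_laplacian_pow[OF less.prems(1)]]) (use that less.prems in auto)
  qed
  ultimately have "spherical_hom d L (\<lambda>x. ?h x + ?g x)" by (rule spherical_hom_add)
  then show ?case
  proof (rule spherical_hom_cong)
    fix z :: "real vec" assume "z \<in> unit_sphere d"
    then have "?h z = (\<Sum>j\<in>{..?n}. of_real (harmonic_coeff d k j) * (laplacian d ^^ j) f z)"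
      by (simp add: harmonic_part_def unit_sphere_iff)
    \<comment> \<open>The summand for 0 is \<open>f z\<close>, since its coefficient is an empty
      product; \<open>?g\<close> cancels all others.\<close>
    also have "{..?n} = insert 0 {1..?n}" by auto
    finally show "?h z + ?g z = f z"
      by (simp add: harmonic_coeff_def sum_negf)
  qed
qed

lemma spherical_hom_imp_spherical_harmonics:
  assumes "spherical_hom d L f"
  shows "\<exists>h\<in>spherical_harmonics d L. \<forall>z\<in>unit_sphere d. f z = h z"
proof -
  obtain a where a: "\<And>k. k \<le> L \<Longrightarrow> hom_poly d k (a k)"
     "\<And>k x. k \<le> L \<Longrightarrow> x\<in>carrier_vec d \<Longrightarrow> laplacian d (a k) x = 0"
     "\<And>z. z\<in>unit_sphere d \<Longrightarrow> f z = (\<Sum>k\<le>L. a k z)"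
    using assms(1) unfolding spherical_hom_def by blast
  let ?h = "\<lambda>k. restrict (a k) (unit_sphere d)"
  have "\<forall>k\<le>L. ?h k \<in> Harm d k"
    using harmonic_hom_poly_in_Harm[OF a(1) a(2)] by simp
  then have "(\<lambda>z\<in>unit_sphere d. \<Sum>k\<le>L. ?h k z) \<in> spherical_harmonics d L"
    unfolding spherical_harmonics_def by (intro CollectI exI[of _ ?h]) simp
  then show ?thesis by (rule bexI[rotated]) (simp add: a(3))
qed

subsection \<open>Linear substitutions\<close>

text \<open>Expanding row \<open>i\<close> of \<open>R\<close> reduces a linear form to rule
  \<open>coord\<close>.\<close>

lemma hom_poly_linear_mult:
  assumes "hom_poly d k f" "R \<in> carrier_mat n d" "i < n"
  shows "hom_poly d (Suc k) (\<lambda>x. of_real ((R *\<^sub>v x) $ i) * f x)"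
proof (rule hom_poly.cong)
  show "hom_poly d (Suc k) (\<lambda>x. \<Sum>j<d. of_real (R $$ (i, j)) * (of_real (x $ j) * f x))"
    by (intro hom_poly_sum hom_poly_scale hom_poly.coord assms) simp
  show "(\<Sum>j<d. of_real (R $$ (i, j)) * (of_real (x $ j) * f x)) = of_real ((R *\<^sub>v x) $ i) * f x"
    if "x \<in> carrier_vec d" for x
    using that assms(2,3)
    by (simp add: scalar_prod_def atLeast0LessThan sum_distrib_right mult.assoc)
qed

lemma hom_poly_linear_pow_mult:
  assumes "hom_poly d k f" "R \<in> carrier_mat n d" "i < n"
  shows "hom_poly d (m + k) (\<lambda>x. of_real ((R *\<^sub>v x) $ i) ^ m * f x)"
proof (induction m)
  case (Suc m)
  from hom_poly_linear_mult[OF this assms(2,3)] show ?case by (simp add: mult.assoc)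
qed (simp add: assms)

text \<open>The bound \<open>m\<close> carries the induction; the theorem takes
  \<open>m = d - 1\<close> because \<open>proj_inv\<close> drops the last coordinate.\<close>

lemma hom_poly_linear_monomial:
  assumes "R \<in> carrier_mat n d" "m \<le> n"
  shows "hom_poly d (\<Sum>i<m. e i) (\<lambda>x. \<Prod>i<m. of_real ((R *\<^sub>v x) $ i) ^ e i)"
  using assms(2)
proof (induction m)
  case 0
  show ?case using hom_poly.const[of d 1] by simp
next
  case (Suc m)
  from hom_poly_linear_pow_mult[OF Suc.IH assms(1), of m "e m"] Suc.prems
  show ?case by (simp add: ac_simps)
qed

theorem lemma5p3:
  fixes d L :: nat and y :: "real vec" and R :: "real mat"
    and p :: "real vec \<Rightarrow> 'k::real_normed_field"
  assumes "d \<ge> 2"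
    and "y \<in> unit_sphere d"
    and "R \<in> special_orthogonal d" and "R *\<^sub>v y = north_pole d"
    and "p \<in> tangent_polys d L R y"
  shows "\<exists>h\<in>spherical_harmonics d L. \<forall>z\<in>cap d (pi / 2) y. p z = h z"
proof -
  let ?A = "{\<alpha>. length \<alpha> = d - 1 \<and> sum_list \<alpha> \<le> L}"
  have R: "R \<in> carrier_mat d d" using assms(3) by (simp add: special_orthogonal_def)
  obtain c where p: "p = (\<lambda>z\<in>cap d (pi / 2) y.
      (\<lambda>x\<in>carrier_vec (d - 1). \<Sum>\<alpha>\<in>?A. c \<alpha> * of_real (monomial_fun \<alpha> x)) (proj_inv d (R *\<^sub>v z)))"
    using assms(5) unfolding tangent_polys_def polys_def by (elim CollectE exE conjE) simp
  \<comment> \<open>A polynomial extension of \<open>p\<close> to the whole space: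
    \<open>proj_inv\<close> only discards a coordinate, so no square root appears.\<close>
  let ?f = "\<lambda>x. \<Sum>\<alpha>\<in>?A. c \<alpha> * (\<Prod>i<d - 1. of_real ((R *\<^sub>v x) $ i) ^ (\<alpha> ! i))"
  have "spherical_hom d L ?f"
  proof (intro spherical_hom_sum spherical_hom_scale)
    fix \<alpha> assume \<alpha>: "\<alpha> \<in> ?A"
    \<comment> \<open>Different multi-indices give different degrees, all at most \<open>L\<close>,
      so each monomial is decomposed separately.\<close>
    then have "(\<Sum>i<d - 1. \<alpha> ! i) \<le> L"
      by (auto simp: sum_list_sum_nth atLeast0LessThan)
    with assms(1)
    show "spherical_hom d L (\<lambda>x. \<Prod>i<d - 1. of_real ((R *\<^sub>v x) $ i) ^ (\<alpha> ! i) :: 'k)"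
      by (intro hom_poly_spherical_hom[OF hom_poly_linear_monomial[OF R]]) simp_all
  qed
  then obtain h where h: "h \<in> spherical_harmonics d L" "\<And>z. z \<in> unit_sphere d \<Longrightarrow> ?f z = h z"
    using spherical_hom_imp_spherical_harmonics by blast
  have "p z = h z" if z: "z \<in> cap d (pi / 2) y" for z
  proof -
    \<comment> \<open>The inner restriction can be evaluated because \<open>proj_inv\<close> always
      yields a vector of dimension \<open>d - 1\<close>.\<close>
    have "p z = (\<Sum>\<alpha>\<in>?A. c \<alpha> * of_real (monomial_fun \<alpha> (proj_inv d (R *\<^sub>v z))))"
      using z by (simp add: p proj_inv_def)
    also have "\<dots> = ?f z"
      by (intro sum.cong refl) (simp add: monomial_fun_def proj_inv_def vec_first_def del: index_mult_mat_vec)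
    also have "\<dots> = h z"
      using z by (intro h(2)) (simp add: cap_def)
    finally show ?thesis .
  qed
  with h(1) show ?thesis by blast
qed

end
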